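(* Let $q=2^s$ and $r=2^t$, where $s,t\geq 1$ are integers. Let $\ell\geq 1$ be an integer and let $(\lambda_1,\lambda_2,\dots,\lambda_\ell,\epsilon_1,\epsilon_2)\in(\mathbb{F}_q^* )^{\ell+2}$. Let $x_\ell,y_\ell,x_{\ell-1},y_{\ell-1}\in\mathbb{F}_q[T]$ be the continuants built from the vector $(\lambda_1T,\lambda_2T,\dots,\lambda_\ell T)$, namely $x_n=\langle \lambda_1T,\dots,\lambda_nT\rangle$ and $y_n=\langle \lambda_2T,\dots,\lambda_nT\rangle$ (so that $x_n/y_n=[\lambda_1T,\dots,\lambda_nT]$), with $x_0=1$, $y_0=0$. Consider the algebraic equation $$y_{\ell}X^{r+1}+x_{\ell}X^{r}+(\epsilon_1y_{\ell-1}F_{r-1}+\epsilon_2y_{\ell}F_{r-2})X+\epsilon_2x_{\ell}F_{r-2}+\epsilon_1x_{\ell-1}F_{r-1}=0.$$ Then this equation has a unique root $\alpha$ in $\mathbb{F}(q)^{+}$, and its continued fraction expansion is $\alpha=[\lambda_1T,\lambda_2T,\dots,\lambda_\ell T,\dots,\lambda_nT,\dots]$, where the sequence $(\lambda_n)_{n\geq1}$ in $\mathbb{F}_q^*$ extends the given $\lambda_1,\dots,\lambda_\ell$ and is defined recursively by $$\lambda_{\ell+rm+1}=(\epsilon_2/\epsilon_1)\,\epsilon_2^{(-1)^{m+1}}\lambda_{m+1}^r\quad\text{and}\quad \lambda_{\ell+rm+i}=(\epsilon_1/\epsilon_2)^{(-1)^i}\quad\text{for } m\geq 0 \text{ and }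 2\leq i\leq r.$$
   Context: $\mathbb{F}_q$ is the finite field with $q$ elements and $\mathbb{F}(q)$ is the field of formal power series (Laurent series) in $1/T$ with coefficients in $\mathbb{F}_q$, i.e. elements $\sum_{k\leq k_0}a_kT^k$, with the absolute value $|\alpha|=|T|^{k_0}$ for $a_{k_0}\neq0$ (fixed $|T|>1$). Every irrational element of $\mathbb{F}(q)$ has an infinite continued fraction expansion $[a_1,a_2,\dots]$ with $a_i\in\mathbb{F}_q[T]$ and $\deg a_i>0$ for $i>1$. $\mathbb{F}(q)^{+}$ denotes the set of elements of $\mathbb{F}(q)$ whose integral part (first partial quotient) has positive degree. Continuants: $\langle\,\rangle=1$, $\langle a_1\rangle=a_1$, $\langle a_1,\dots,a_n\rangle=a_n\langle a_1,\dots,a_{n-1}\rangle+\langle a_1,\dots,a_{n-2}\rangle$. The polynomials $F_n\in\mathbb{F}_2[T]\subset\mathbb{F}_q[T]$ are defined by $F_0=1$, $F_1=T$, $F_{n+1}=TF_n+F_{n-1}$ for $n\geq1$. *)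

theory Defs
  imports "HOL-Computational_Algebra.Computational_Algebra" "HOL-Library.Cardinality"
begin

text \<open>
  The field of power series in $1/T$ over a field is the type \<^typ>\<open>'a fls\<close> of formal Laurent
  series, with the library's indeterminate in the role of $1/T$; thus $T$ is \<^term>\<open>fls_X_inv\<close>, and
  the coefficient of $T^k$ in \<open>f\<close> has index \<open>-k\<close>.  The library's metric on this type is the one
  induced by the absolute value with $|T| = 2$, as \<open>fls_subdegree f\<close> is minus the degree in $T$.
\<close>

definition poly_to_F :: "'a::field poly \<Rightarrow> 'a fls" where
  "poly_to_F p = poly (map_poly fls_const p) fls_X_inv"

text \<open>The library's \<^const>\<open>fls_prpart\<close> has no constant term, so it is added here.\<close>

definition integral_part :: "'a::field fls \<Rightarrow> 'a poly" where
  "integral_part \<alpha> = fls_prpart \<alpha> + [:fls_nth \<alpha> 0:]"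

definition F_plus :: "'a::field fls set" where
  "F_plus = {\<alpha>. degree (integral_part \<alpha>) > 0}"

text \<open>Sequences of partial quotients are indexed from 1; the value at 0 is never used.\<close>

fun finite_cfrac :: "'b::field list \<Rightarrow> 'b" where
  "finite_cfrac [] = 0"
| "finite_cfrac [a] = a"
| "finite_cfrac (a # b # as) = a + 1 / finite_cfrac (b # as)"

definition has_cfrac_expansion :: "'a::field fls \<Rightarrow> (nat \<Rightarrow> 'a poly) \<Rightarrow> bool" where
  "has_cfrac_expansion \<alpha> a \<longleftrightarrow>
     (\<forall>i>1. degree (a i) > 0) \<and>
     (\<lambda>n. finite_cfrac (map (\<lambda>i. poly_to_F (a i)) [1..<Suc n])) \<longlonglongrightarrow> \<alpha>"

text \<open>\<open>continuant a n\<close> is the continuant of $a_1, \dots, a_n$.\<close>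

fun continuant :: "(nat \<Rightarrow> 'b::comm_ring_1) \<Rightarrow> nat \<Rightarrow> 'b" where
  "continuant a 0 = 1"
| "continuant a (Suc 0) = a 1"
| "continuant a (Suc (Suc n)) = a (Suc (Suc n)) * continuant a (Suc n) + continuant a n"

text \<open>The polynomial $\lambda_i T$.\<close>

definition lin :: "(nat \<Rightarrow> 'a::field) \<Rightarrow> nat \<Rightarrow> 'a poly" where
  "lin lam i = monom (lam i) 1"

definition cont_x :: "(nat \<Rightarrow> 'a::field) \<Rightarrow> nat \<Rightarrow> 'a poly" where
  "cont_x lam n = continuant (lin lam) n"

definition cont_y :: "(nat \<Rightarrow> 'a::field) \<Rightarrow> nat \<Rightarrow> 'a poly" where
  "cont_y lam n = (if n = 0 then 0 else continuant (\<lambda>i. lin lam (i + 1)) (n - 1))"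

fun F_poly :: "nat \<Rightarrow> 'a::field poly" where
  "F_poly 0 = 1"
| "F_poly (Suc 0) = monom 1 1"
| "F_poly (Suc (Suc n)) = monom 1 1 * F_poly (Suc n) + F_poly n"

definition is_root :: "nat \<Rightarrow> nat \<Rightarrow> (nat \<Rightarrow> 'a::field) \<Rightarrow> 'a \<Rightarrow> 'a \<Rightarrow> 'a fls \<Rightarrow> bool" where
  "is_root r l lam \<epsilon>1 \<epsilon>2 X \<longleftrightarrow>
     poly_to_F (cont_y lam l) * X ^ (r + 1)
   + poly_to_F (cont_x lam l) * X ^ r
   + poly_to_F (smult \<epsilon>1 (cont_y lam (l - 1) * F_poly (r - 1))
              + smult \<epsilon>2 (cont_y lam l * F_poly (r - 2))) * X
   + poly_to_F (smult \<epsilon>2 (cont_x lam l * F_poly (r - 2))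
              + smult \<epsilon>1 (cont_x lam (l - 1) * F_poly (r - 1))) = 0"

end

theory Submission
  imports Defs
begin

text \<open>
  In characteristic 2, $F_{r-1} = T^{r-1}$, and a root is an $\alpha$ whose complete quotient
  $\beta$ after $\ell$ steps satisfies
  $\alpha^r = \epsilon_1 F_{r-1} \beta + \epsilon_2 F_{r-2}$.  Let $\alpha_n$ be the complete quotients of
  the continued fraction $[\lambda_1 T, \lambda_2 T, \dots]$, and put $d_m = \epsilon_2^{(-1)^m}$ and
  $c_m = (\epsilon_1/\epsilon_2) d_m$.  The recursion for the $\lambda_n$ is made so that the error
  $E_m = \alpha_{m+1}^r - (c_m F_{r-1} \alpha_{\ell+rm+1} + d_m F_{r-2})$ is the difference of the reciprocals
  of the two quantities whose difference is $E_{m+1}$.  These have absolute value $|T|^r$, so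
  $|E_m| = |E_{m+1}| / |T|^{2r}$; as the errors are bounded, they vanish, and $E_0 = 0$ says that
  $\alpha_1$ is a root.

  For uniqueness, let $D = y_\ell \alpha + x_\ell$, which is small for every root $\alpha$ in
  $\mathbb{F}(q)^+$.  Two distinct roots would satisfy
  $|\alpha - \alpha'|^{r-1} |D| |D'| = |T|^{r-1}$, although all three factors on the left are less than 1.
\<close>

subsection \<open>The absolute value\<close>

text \<open>Zero is split off because \<open>fls_subdegree 0\<close> is 0, which would give it the
  value 1. The base 2 makes \<open>absF (f - g)\<close> the metric of the type.\<close>

definition absF :: "'a::field fls \<Rightarrow> real" where
  "absF f = (if f = 0 then 0 else 2 powi (- fls_subdegree f))"

lemma absF_0 [simp]: "absF 0 = 0"
  by (simp add: absF_def)

lemma absF_1 [simp]: "absF 1 = 1"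
  by (simp add: absF_def)

lemma absF_eq_0_iff [simp]: "absF f = 0 \<longleftrightarrow> f = 0"
  by (simp add: absF_def)

lemma absF_nonneg [simp]: "absF f \<ge> 0"
  by (simp add: absF_def)

lemma absF_pos_iff: "absF f > 0 \<longleftrightarrow> f \<noteq> 0"
  by (simp add: absF_def)

lemma absF_mult [simp]: "absF (f * g) = absF f * absF g"
  by (simp add: absF_def power_int_add[symmetric])

lemma absF_power [simp]: "absF (f ^ n) = absF f ^ n"
  by (induction n) simp_all

lemma absF_inverse: "absF (inverse f) = inverse (absF f)"
proof (cases "f = 0")
  case False
  then have "absF f * absF (inverse f) = 1"
    by (simp flip: absF_mult)
  then show ?thesis
    using inverse_unique[of "absF f" "absF (inverse f)"] by simp
qed simp

lemma absF_divide [simp]: "absF (f / g) = absF f / absF g"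
  by (simp add: divide_inverse absF_inverse)

lemma absF_uminus [simp]: "absF (- f) = absF f"
  by (simp add: absF_def)

lemma absF_minus_commute: "absF (f - g) = absF (g - f)"
  by (metis absF_uminus minus_diff_eq)

lemma absF_X_inv [simp]: "absF fls_X_inv = 2"
  by (simp add: absF_def)

lemma absF_const: "c \<noteq> 0 \<Longrightarrow> absF (fls_const c) = 1"
  by (simp add: absF_def)

lemma absF_add_le_max: "absF (f + g) \<le> max (absF f) (absF g)"
proof (cases "f = 0 \<or> g = 0 \<or> f + g = 0")
  case True
  then show ?thesis by (auto simp: le_max_iff_disj)
next
  case False
  then have "min (fls_subdegree f) (fls_subdegree g) \<le> fls_subdegree (f + g)"
    using fls_plus_subdegree by blast
  then have "- fls_subdegree (f + g) \<le> - fls_subdegree f \<or> - fls_subdegree (f + g) \<le> - fls_subdegree g"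
    by linarith
  then show ?thesis
    using False by (auto simp: absF_def le_max_iff_disj intro!: power_int_increasing)
qed

lemma absF_add_le: "absF f \<le> c \<Longrightarrow> absF g \<le> c \<Longrightarrow> absF (f + g) \<le> c"
  using absF_add_le_max[of f g] by simp

lemma absF_diff_le: "absF f \<le> c \<Longrightarrow> absF g \<le> c \<Longrightarrow> absF (f - g) \<le> c"
  using absF_add_le[of f c "- g"] by simp

text \<open>The leading term of f cannot cancel: otherwise f, as the difference of f + g and g,
  would be smaller than itself.\<close>

lemma absF_add_eq: "absF g < absF f \<Longrightarrow> absF (f + g) = absF f"
  using absF_add_le_max[of f g] absF_add_le_max[of "f + g" "- g"] by (auto simp: max_def split: if_splits)

lemma dist_fls_eq_absF: "dist f g = absF (f - g)"
  by (simp add: dist_fls_def absF_def power_int_def power_one_over inverse_eq_divide)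

lemma subdegree_ge_iff_nth: "f \<noteq> 0 \<Longrightarrow> k \<le> fls_subdegree f \<longleftrightarrow> (\<forall>j<k. fls_nth f j = 0)"
  using fls_eq0_below_subdegree[of _ f] nth_fls_subdegree_nonzero[of f]
  by (meson linorder_not_le order_less_le_trans)

lemma two_powi_le_iff: "(2::real) powi j \<le> 2 powi k \<longleftrightarrow> j \<le> k"
  using power_int_increasing[of j k "2::real"] power_int_strict_increasing[of k j "2::real"]
  by linarith

text \<open>Translates metric estimates into agreement of coefficients, from which limits are built
  below.\<close>

lemma absF_le_iff_nth: "absF f \<le> 2 powi (- k) \<longleftrightarrow> (\<forall>j<k. fls_nth f j = 0)"
proof (cases "f = 0")
  case False
  then show ?thesis
    by (simp add: absF_def two_powi_le_iff subdegree_ge_iff_nth del: power_int_minus)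
qed simp

text \<open>A nonzero principal part has no constant term, so its degree is positive and adding a
  constant does not change it. Absolute values are powers of 2, so being above 1 means being at
  least 2.\<close>

lemma F_plus_iff_absF: "\<alpha> \<in> F_plus \<longleftrightarrow> absF \<alpha> \<ge> 2"
proof -
  have "degree (integral_part \<alpha>) = degree (fls_prpart \<alpha>)"
  proof (cases "fls_prpart \<alpha> = 0")
    case False
    then have "degree (fls_prpart \<alpha>) > 0"
      by (simp add: fls_prpart_eq0_iff)
    then show ?thesis
      unfolding integral_part_def by (intro degree_add_eq_left) simp
  qed (simp add: integral_part_def)
  then have "\<alpha> \<in> F_plus \<longleftrightarrow> fls_subdegree \<alpha> < 0"
    by (simp add: F_plus_def)
  also have "\<dots> \<longleftrightarrow> 2 \<le> absF \<alpha>"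
    using two_powi_le_iff[of 1 "- fls_subdegree \<alpha>"] by (auto simp: absF_def)
  finally show ?thesis .
qed

section \<open>The embedding of polynomials into the field\<close>

lemma poly_to_F_0 [simp]: "poly_to_F 0 = 0"
  by (simp add: poly_to_F_def)

lemma poly_to_F_pCons [simp]: "poly_to_F (pCons a p) = fls_const a + fls_X_inv * poly_to_F p"
  by (simp add: poly_to_F_def map_poly_pCons)

lemma poly_to_F_1 [simp]: "poly_to_F 1 = 1"
  by (simp add: one_pCons)

lemma poly_to_F_add [simp]: "poly_to_F (p + q) = poly_to_F p + poly_to_F q"
  by (induction p q rule: poly_induct2) (simp_all add: algebra_simps flip: fls_plus_const)

lemma poly_to_F_smult [simp]: "poly_to_F (smult c p) = fls_const c * poly_to_F p"
  by (induction p) (simp_all add: algebra_simps)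

lemma poly_to_F_mult [simp]: "poly_to_F (p * q) = poly_to_F p * poly_to_F q"
  by (induction p) (simp_all add: algebra_simps)

lemma poly_to_F_monom_1 [simp]: "poly_to_F (monom c (Suc 0)) = fls_const c * fls_X_inv"
  by (simp add: monom_altdef)

lemma poly_to_F_continuant: "poly_to_F (continuant a n) = continuant (\<lambda>i. poly_to_F (a i)) n"
  by (induction a n rule: continuant.induct) simp_all

subsection \<open>Continuants\<close>

text \<open>\<open>tail_continuant a n\<close> is the continuant of $a_2, \dots, a_n$, that is, the paper's $y_n$ with $y_0 = 0$.\<close>

fun tail_continuant :: "(nat \<Rightarrow> 'b::comm_ring_1) \<Rightarrow> nat \<Rightarrow> 'b" where
  "tail_continuant a 0 = 0"
| "tail_continuant a (Suc n) = continuant (\<lambda>i. a (i + 1)) n"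

lemma tail_continuant_rec:
  "tail_continuant a (Suc (Suc n)) = a (Suc (Suc n)) * tail_continuant a (Suc n) + tail_continuant a n"
  by (cases n) simp_all

lemma poly_to_F_cont_x: "poly_to_F (cont_x lam n) = continuant (\<lambda>i. poly_to_F (lin lam i)) n"
  by (simp add: cont_x_def poly_to_F_continuant)

lemma poly_to_F_cont_y: "poly_to_F (cont_y lam n) = tail_continuant (\<lambda>i. poly_to_F (lin lam i)) n"
  by (cases n) (simp_all add: cont_y_def poly_to_F_continuant)

lemma continuant_cong: "(\<And>i. 1 \<le> i \<Longrightarrow> i \<le> n \<Longrightarrow> a i = b i) \<Longrightarrow> continuant a n = continuant b n"
  by (induction a n rule: continuant.induct) auto

lemma tail_continuant_cong: "(\<And>i. 1 \<le> i \<Longrightarrow> i \<le> n \<Longrightarrow> a i = b i) \<Longrightarrow> tail_continuant a n = tail_continuant b n"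
  by (cases n) (auto intro!: continuant_cong)

lemma absF_continuant:
  assumes "\<And>i. 1 \<le> i \<Longrightarrow> i \<le> n \<Longrightarrow> absF (a i) = 2"
  shows "absF (continuant a n) = 2 ^ n"
  using assms
proof (induction a n rule: continuant.induct)
  case (3 a n)
  then have "absF (continuant a n) = 2 ^ n" "absF (continuant a (Suc n)) = 2 ^ Suc n" "absF (a (Suc (Suc n))) = 2"
    by auto
  then show ?case by (simp add: absF_add_eq)
qed auto

lemma absF_tail_continuant:
  assumes "\<And>i. 1 \<le> i \<Longrightarrow> i \<le> Suc n \<Longrightarrow> absF (a i) = 2"
  shows "absF (tail_continuant a (Suc n)) = 2 ^ n"
  using assms by (auto intro!: absF_continuant)

text \<open>The determinant of a product of the matrices with rows (a, 1) and (1, 0), each of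
  determinant -1; in characteristic 2 all signs disappear.\<close>

lemma continuant_det:
  assumes "(2::'b::comm_ring_1) = 0"
  shows "continuant a (Suc n) * tail_continuant a n + continuant a n * tail_continuant a (Suc n) = (1::'b)"
proof (induction n)
  case (Suc n)
  let ?x = "continuant a" and ?y = "tail_continuant a"
  have "?x (Suc (Suc n)) * ?y (Suc n) + ?x (Suc n) * ?y (Suc (Suc n))
      = 2 * a (Suc (Suc n)) * ?x (Suc n) * ?y (Suc n) + (?x (Suc n) * ?y n + ?x n * ?y (Suc n))"
    by (simp only: tail_continuant_rec continuant.simps) (simp only: ring_distribs ac_simps mult_2 one_add_one[symmetric] mult_1_left)
  then show ?case using assms Suc by simp
qed simp

text \<open>\<open>C 1\<close> is the image of a later complete quotient under the Moebius map with
  the continuants as coefficients, written without division. One step of the recursion multiplies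
  numerator and denominator by the same factor.\<close>

lemma cfrac_tail:
  fixes C a :: "nat \<Rightarrow> 'b::field"
  assumes "\<And>i. i \<ge> 1 \<Longrightarrow> C i = a i + 1 / C (Suc i)" and "\<And>i. i \<ge> 1 \<Longrightarrow> C i \<noteq> 0"
  shows "C 1 * (tail_continuant a (Suc n) * C (Suc (Suc n)) + tail_continuant a n)
       = continuant a (Suc n) * C (Suc (Suc n)) + continuant a n"
proof (induction n)
  case 0
  show ?case using assms(1)[of 1] assms(2)[of 2] by (simp add: field_simps numeral_2_eq_2)
next
  case (Suc n)
  let ?x = "continuant a" and ?y = "tail_continuant a" and ?Z = "C (Suc (Suc (Suc n)))"
  have Z: "C (Suc (Suc n)) * ?Z = a (Suc (Suc n)) * ?Z + 1"
    using assms(1)[of "Suc (Suc n)"] assms(2)[of "Suc (Suc (Suc n))"] by (simp add: field_simps)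
  have "?y (Suc (Suc n)) * ?Z + ?y (Suc n) = (?y (Suc n) * C (Suc (Suc n)) + ?y n) * ?Z"
    using Z by (simp only: tail_continuant_rec) algebra
  moreover have "?x (Suc (Suc n)) * ?Z + ?x (Suc n) = (?x (Suc n) * C (Suc (Suc n)) + ?x n) * ?Z"
    using Z by (simp only: continuant.simps) algebra
  ultimately show ?case using Suc by (metis mult.assoc)
qed

section \<open>Characteristic 2: the polynomials \<open>F_poly\<close>, powers of sums, alternating
  continuants\<close>

lemma F_poly_double:
  assumes "(2::'a::field) = 0"
  shows "F_poly (2 * n + 1) = monom 1 1 * (F_poly n :: 'a poly)\<^sup>2
       \<and> F_poly (2 * n + 2) = (F_poly (n + 1) :: 'a poly)\<^sup>2 + (F_poly n)\<^sup>2"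
proof (induction n)
  case 0
  show ?case by (simp add: power2_eq_square)
next
  case (Suc n)
  have two: "(2 :: 'a poly) = 0"
    using assms by (simp add: numeral_poly)
  let ?T = "monom 1 1 :: 'a poly" and ?F = "F_poly :: nat \<Rightarrow> 'a poly"
  note ih = conjunct1[OF Suc] conjunct2[OF Suc]
  \<comment> \<open>Squaring is additive up to doubled cross terms, which vanish, so the recursion
    reproduces itself at doubled indices. Each of the two formulas needs the other at the previous
    stage.\<close>
  have 1: "?F (2 * Suc n + 1) = ?T * (?F (Suc n))\<^sup>2"
  proof -
    have "?F (2 * Suc n + 1) = ?T * ?F (2 * n + 2) + ?F (2 * n + 1)" by simp
    also have "\<dots> = ?T * (?F (Suc n))\<^sup>2 + 2 * (?T * (?F n)\<^sup>2)"
      by (simp only: ih) (simp add: algebra_simps)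
    finally show ?thesis using two by simp
  qed
  have "?F (2 * Suc n + 2) = ?T * ?F (2 * Suc n + 1) + ?F (2 * n + 2)" by simp
  also have "\<dots> = ?T * (?T * (?F (Suc n))\<^sup>2) + ((?F (Suc n))\<^sup>2 + (?F n)\<^sup>2)"
    by (simp only: 1 ih) (simp only: Suc_eq_plus1)
  also have "\<dots> = (?T * ?F (Suc n) + ?F n)\<^sup>2 + (?F (Suc n))\<^sup>2 - 2 * (?T * ?F (Suc n) * ?F n)"
    by (simp add: power2_eq_square algebra_simps)
  also have "\<dots> = (?F (Suc n + 1))\<^sup>2 + (?F (Suc n))\<^sup>2" using two by simp
  finally show ?case using 1 by simp
qed

lemma F_poly_pow2:
  assumes "(2::'a::field) = 0"
  shows "(F_poly (2 ^ t - 1) :: 'a poly) = monom 1 1 ^ (2 ^ t - 1)"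
proof (induction t)
  case (Suc t)
  have e: "2 ^ Suc t - 1 = 2 * (2 ^ t - 1) + (1::nat)"
    by (cases "2 ^ t :: nat") simp_all
  show ?case
    unfolding e conjunct1[OF F_poly_double[OF assms]] Suc
    by (simp only: power_add power_mult[symmetric] mult.commute power_one_right)
qed simp

lemma absF_F_poly: "absF (poly_to_F (F_poly n :: 'a::field poly)) = 2 ^ n"
proof (induction n rule: F_poly.induct)
  case (3 n)
  then show ?case by (simp add: absF_add_eq absF_const)
qed (simp_all add: absF_const)

text \<open>The t-fold iterate of the Frobenius map, which is additive.\<close>

lemma power_pow2_add:
  fixes x y :: "'b::comm_ring_1"
  assumes "(2::'b) = 0"
  shows "(x + y) ^ (2 ^ t) = x ^ (2 ^ t) + y ^ (2 ^ t)"
proof (induction t)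
  case (Suc t)
  have "(x + y) ^ (2 ^ Suc t) = (x ^ (2 ^ t) + y ^ (2 ^ t))\<^sup>2"
    by (simp add: Suc.IH[symmetric] power_mult[symmetric] mult.commute)
  also have "\<dots> = (x ^ (2 ^ t))\<^sup>2 + (y ^ (2 ^ t))\<^sup>2"
    using assms by (simp add: power2_sum)
  finally show ?case by (simp add: power_mult[symmetric] mult.commute)
qed simp

text \<open>Multiplying the continued fraction [T, T, ...] by u gives [uT, T/u, uT, ...]; on
  continuants this leaves one factor u for odd length and none for even length.\<close>

lemma continuant_alternating:
  fixes u :: "'a::field"
  assumes "u \<noteq> 0" and "\<And>i. 1 \<le> i \<Longrightarrow> i \<le> n \<Longrightarrow> a i = fls_const (if odd i then u else inverse u) * fls_X_inv"
  shows "continuant a n = fls_const (if odd n then u else 1) * poly_to_F (F_poly n)"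
  using assms(2)
proof (induction a n rule: continuant.induct)
  case (3 a n)
  have "continuant a n = fls_const (if odd n then u else 1) * poly_to_F (F_poly n)"
    "continuant a (Suc n) = fls_const (if odd (Suc n) then u else 1) * poly_to_F (F_poly (Suc n))"
    using 3 by auto
  moreover have "a (Suc (Suc n)) = fls_const (if odd n then u else inverse u) * fls_X_inv"
    using 3(3) by simp
  moreover have "fls_const (inverse u) * fls_const u = 1"
    using assms(1) by simp
  then have "fls_const (inverse u) * fls_X_inv * (fls_const u * poly_to_F (F_poly (Suc n)))
      = fls_X_inv * poly_to_F (F_poly (Suc n))"
    by algebra
  ultimately show ?case
    by (cases "odd n") (simp_all add: ring_distribs mult.assoc mult.left_commute[of fls_X_inv "fls_const _"] del: fls_const_mult_const)
qed simp_all

text \<open>Translation by 1 permutes the field, so the sum of all elements is unchanged when the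
  number of elements, a power of 2, is added to it.\<close>

lemma two_eq_0_of_CARD:
  assumes "CARD('a::{field,finite}) = 2 ^ s"
  shows "(2::'a) = 0"
proof -
  have "(\<Sum>x\<in>UNIV. x) = (\<Sum>x\<in>UNIV. x + (1::'a))"
    by (rule sum.reindex_bij_betw[symmetric, where h = "\<lambda>x. x + 1"])
      (auto simp: bij_def inj_def surj_def intro: exI[of _ "_ - 1"])
  then have "of_nat (CARD('a)) = (0::'a)"
    by (simp add: sum.distrib)
  then show ?thesis using assms by simp
qed

subsection \<open>Convergence of continued fractions\<close>

text \<open>The starting index is free, so that an induction on the length can pass to the tail
  beginning at \<open>Suc n\<close>.\<close>

fun cfrac_trunc :: "(nat \<Rightarrow> 'b::field) \<Rightarrow> nat \<Rightarrow> nat \<Rightarrow> 'b" where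
  "cfrac_trunc a n 0 = a n"
| "cfrac_trunc a n (Suc k) = a n + 1 / cfrac_trunc a (Suc n) k"

lemma finite_cfrac_eq_trunc: "finite_cfrac (map a [n..<n + Suc k]) = cfrac_trunc a n k"
proof (induction k arbitrary: n)
  case (Suc k)
  have "[n..<n + Suc (Suc k)] = n # Suc n # [Suc (Suc n)..<n + Suc (Suc k)]"
    by (simp add: upt_conv_Cons del: upt_Suc)
  moreover have "[Suc n..<Suc n + Suc k] = Suc n # [Suc (Suc n)..<n + Suc (Suc k)]"
    by (simp add: upt_conv_Cons del: upt_Suc)
  ultimately show ?case
    using Suc[of "Suc n"] by (simp del: upt_Suc)
qed simp

lemma absF_eq_0_of_le:
  assumes "\<And>k. absF f \<le> K * (1 / 2) ^ k"
  shows "f = 0"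
proof -
  have "(\<lambda>k. K * (1 / 2) ^ k) \<longlonglongrightarrow> K * 0"
    by (intro tendsto_intros LIMSEQ_power_zero) simp
  then have "absF f \<le> 0"
    using assms by (intro LIMSEQ_le_const) auto
  then show ?thesis
    using absF_pos_iff[of f] by force
qed

text \<open>Completeness with a rate: the terms k and k + 1 agree in all coefficients up to index k,
  so the limit can be read off coefficientwise, and the bound for one step holds for all later ones
  too.\<close>

lemma fls_limit_exists:
  fixes f :: "nat \<Rightarrow> 'a::field fls"
  assumes "\<And>k. absF (f (Suc k) - f k) \<le> (1 / 2) ^ Suc k"
  shows "\<exists>L. \<forall>k. absF (L - f k) \<le> (1 / 2) ^ Suc k"
proof -
  have pw: "(1 / 2 :: real) ^ Suc k = 2 powi (- int (Suc k))" for k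
    by (simp only: power_int_minus power_int_of_nat power_one_over inverse_eq_divide)
  have step: "fls_nth (f (Suc k)) j = fls_nth (f k) j" if "j \<le> int k" for j k
  proof -
    have "\<forall>j < int (Suc k). fls_nth (f (Suc k) - f k) j = 0"
      using assms[of k] unfolding pw by (subst absF_le_iff_nth[symmetric])
    then show ?thesis using that by simp
  qed
  \<comment> \<open>The coefficient of index \<open>j\<close> no longer changes from \<open>f (nat j)\<close> on.\<close>
  have stable: "fls_nth (f k) j = fls_nth (f (nat j)) j" if "j \<le> int k" for j k
  proof -
    from that have "nat j \<le> k" by linarith
    then show ?thesis
    proof (induction k rule: dec_induct)
      case (step k)
      then show ?case using \<open>\<And>k j. j \<le> int k \<Longrightarrow> _\<close>[of j k] by simp
    qed simp
  qed
  define L where "L = Abs_fls (\<lambda>j. fls_nth (f (nat j)) j)"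
  have L: "fls_nth L j = fls_nth (f (nat j)) j" for j
  proof -
    \<comment> \<open>For negative j, \<open>nat j\<close> is 0, so these coefficients are those of
      \<open>f 0\<close>; they vanish far enough down, and \<open>L\<close> is a genuine Laurent
      series.\<close>
    have "\<forall>j < min 0 (fls_subdegree (f 0)). fls_nth (f (nat j)) j = 0"
      by simp
    then show ?thesis
      unfolding L_def by (rule nth_Abs_fls_lower_bound)
  qed
  have "absF (L - f k) \<le> (1 / 2) ^ Suc k" for k
    unfolding pw absF_le_iff_nth using L stable[of _ k] by simp
  then show ?thesis by blast
qed

text \<open>The difference of the reciprocals is (y - x) / (x y), and 4 is the least possible size
  of x y. This contraction drives both the convergence and the error estimate for the root.\<close>

lemma absF_reciprocal_diff_le:
  assumes "absF x \<ge> 2" "absF y \<ge> 2"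
  shows "absF (1 / x - 1 / y) \<le> absF (x - y) / 4"
proof -
  from assms have nz: "x \<noteq> 0" "y \<noteq> 0" by auto
  then have "1 / x - 1 / y = (y - x) / (x * y)"
    by (simp add: field_simps)
  then have "absF (1 / x - 1 / y) = absF (x - y) / (absF x * absF y)"
    by (simp add: absF_minus_commute)
  also have "\<dots> \<le> absF (x - y) / (2 * 2)"
    using assms by (intro divide_left_mono mult_mono mult_pos_pos) auto
  finally show ?thesis by simp
qed

lemma absF_cfrac_trunc:
  assumes "\<And>i. i \<ge> n \<Longrightarrow> absF (a i) \<ge> 2"
  shows "absF (cfrac_trunc a n k) = absF (a n)"
  using assms
proof (induction k arbitrary: n)
  case (Suc k)
  have "absF (cfrac_trunc a (Suc n) k) \<ge> 2"
    using Suc by simp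
  then have "absF (1 / cfrac_trunc a (Suc n) k) \<le> 1 / 2"
    by (simp add: divide_simps)
  then show ?case
    using Suc(2)[of n] by (simp add: absF_add_eq)
qed simp

lemma absF_cfrac_trunc_diff:
  assumes "\<And>i. i \<ge> n \<Longrightarrow> absF (a i) \<ge> 2"
  shows "absF (cfrac_trunc a n (Suc k) - cfrac_trunc a n k) \<le> (1 / 2) ^ Suc k"
  using assms
proof (induction k arbitrary: n)
  case 0
  have "absF (1 / a (Suc n)) \<le> 1 / 2"
    using 0[of "Suc n"] by (simp add: divide_simps)
  then show ?case by simp
next
  case (Suc k)
  let ?x = "cfrac_trunc a (Suc n) (Suc k)" and ?y = "cfrac_trunc a (Suc n) k"
  have xy: "absF ?x \<ge> 2" "absF ?y \<ge> 2"
    using Suc(2) by (simp_all add: absF_cfrac_trunc del: cfrac_trunc.simps)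
  have "absF (cfrac_trunc a n (Suc (Suc k)) - cfrac_trunc a n (Suc k)) = absF (1 / ?x - 1 / ?y)"
    by (subst (1 2) cfrac_trunc.simps) (simp del: cfrac_trunc.simps)
  also have "\<dots> \<le> absF (?x - ?y) / 4"
    using xy by (rule absF_reciprocal_diff_le)
  also have "\<dots> \<le> (1 / 2) ^ Suc k / 4"
    using Suc by (intro divide_right_mono) auto
  also have "\<dots> \<le> (1 / 2) ^ Suc (Suc k)"
    by simp
  finally show ?case .
qed

lemma cfrac_complete_quotients:
  fixes a :: "nat \<Rightarrow> 'a::field fls"
  assumes a: "\<And>i. i \<ge> 1 \<Longrightarrow> absF (a i) \<ge> 2"
  obtains C where "\<forall>i\<ge>1. C i = a i + 1 / C (Suc i)"
    and "\<forall>i\<ge>1. absF (C i) = absF (a i)"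
    and "(\<lambda>n. finite_cfrac (map a [1..<Suc n])) \<longlonglongrightarrow> C 1"
proof -
  \<comment> \<open>One limit for every starting index: these are the complete quotients.\<close>
  have "\<exists>L. \<forall>k. absF (L - cfrac_trunc a i k) \<le> (1 / 2) ^ Suc k" if "i \<ge> 1" for i
    using that a by (intro fls_limit_exists absF_cfrac_trunc_diff) auto
  then obtain C where C: "absF (C i - cfrac_trunc a i k) \<le> (1 / 2) ^ Suc k" if "i \<ge> 1" for i k
    by metis
  have absC: "absF (C i) = absF (a i)" if "i \<ge> 1" for i
  proof -
    \<comment> \<open>The truncation of length parameter 0 is \<open>a i\<close> itself, so
      \<open>C i\<close> is within 1/2 of it.\<close>
    have "absF (C i - a i) < absF (a i)"
      using C[OF that, of 0] a[OF that] by simp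
    then show ?thesis
      using absF_add_eq[of "C i - a i" "a i"] by simp
  qed
  have rec: "C i = a i + 1 / C (Suc i)" if i: "i \<ge> 1" for i
  proof -
    have "absF (C i - (a i + 1 / C (Suc i))) \<le> 1 * (1 / 2) ^ k" for k
    proof -
      let ?w = "cfrac_trunc a (Suc i) k"
      have "absF (C i - cfrac_trunc a i (Suc k)) \<le> (1 / 2) ^ Suc (Suc k)"
        using C i by blast
      also have "\<dots> \<le> (1 / 2) ^ k" by simp
      finally have 1: "absF (C i - cfrac_trunc a i (Suc k)) \<le> (1 / 2) ^ k" .
      have "absF (1 / ?w - 1 / C (Suc i)) \<le> absF (?w - C (Suc i)) / 4"
        using i a by (intro absF_reciprocal_diff_le) (simp_all add: absC absF_cfrac_trunc)
      also have "\<dots> \<le> (1 / 2) ^ Suc k / 4"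
        using C[of "Suc i" k] by (simp add: absF_minus_commute)
      also have "\<dots> \<le> (1 / 2) ^ k" by simp
      finally have 2: "absF (1 / ?w - 1 / C (Suc i)) \<le> (1 / 2) ^ k" .
      \<comment> \<open>The truncation at i with parameter \<open>Suc k\<close> is
        \<open>a i + 1 / ?w\<close>, so the truncations cancel.\<close>
      have "C i - (a i + 1 / C (Suc i)) = (C i - cfrac_trunc a i (Suc k)) + (1 / ?w - 1 / C (Suc i))"
        by simp
      then show ?thesis
        using absF_add_le[OF 1 2] by (simp only: mult_1_left)
    qed
    from absF_eq_0_of_le[OF this] show ?thesis by simp
  qed
  \<comment> \<open>The index is shifted by one because n = 0 is the empty fraction, which is no
    truncation.\<close>
  have lim: "(\<lambda>n. finite_cfrac (map a [1..<Suc n])) \<longlonglongrightarrow> C 1"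
  proof (subst filterlim_sequentially_Suc[symmetric], rule metric_tendsto_imp_tendsto)
    show "(\<lambda>k. (1 / 2 :: real) ^ Suc k) \<longlonglongrightarrow> 0"
      by (rule LIMSEQ_Suc, rule LIMSEQ_power_zero) simp
    have "finite_cfrac (map a [1..<Suc (Suc k)]) = cfrac_trunc a 1 k" for k
      using finite_cfrac_eq_trunc[of a 1 k] by simp
    then show "\<forall>\<^sub>F k in sequentially. dist (finite_cfrac (map a [1..<Suc (Suc k)])) (C 1) \<le> dist ((1 / 2 :: real) ^ Suc k) 0"
      using C[of 1] by (simp add: dist_fls_eq_absF absF_minus_commute dist_real_def del: upt_Suc)
  qed
  show ?thesis
    by (rule that[of C]) (use rec in blast, use absC in blast, rule lim)
qed

subsection \<open>The equation and its root\<close>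

text \<open>The difference between a continued fraction and its convergent is the determinant, here
  1, over the product of the two denominators.\<close>

lemma reciprocal_cfrac_block:
  fixes C a :: "nat \<Rightarrow> 'b::field"
  assumes two: "(2::'b) = 0"
    and C: "\<And>i. i \<ge> 1 \<Longrightarrow> C i = a i + 1 / C (Suc i)" "\<And>i. i \<ge> 1 \<Longrightarrow> C i \<noteq> 0"
    and nz: "continuant a (Suc n) \<noteq> 0"
      "continuant a (Suc n) * C (Suc (Suc n)) + continuant a n \<noteq> 0"
  shows "1 / C 1 = tail_continuant a (Suc n) / continuant a (Suc n)
    + 1 / (continuant a (Suc n) * (continuant a (Suc n) * C (Suc (Suc n)) + continuant a n))"
proof -
  define x x' y y' Z where "x = continuant a (Suc n)" and "x' = continuant a n"
    and "y = tail_continuant a (Suc n)" and "y' = tail_continuant a n" and "Z = C (Suc (Suc n))"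
  have eq: "C 1 * (y * Z + y') = x * Z + x'"
    unfolding x_def x'_def y_def y'_def Z_def using C by (rule cfrac_tail)
  have "x * y' + x' * y = 1"
    unfolding x_def x'_def y_def y'_def using two by (rule continuant_det)
  moreover have "x * (y * Z + y') = y * (x * Z + x') + (x * y' + x' * y) - 2 * (x' * y)"
    by algebra
  ultimately have *: "x * (y * Z + y') = y * (x * Z + x') + 1"
    using two by simp
  have nz': "x \<noteq> 0" "x * Z + x' \<noteq> 0" "C 1 \<noteq> 0"
    using nz C(2)[of 1] by (simp_all add: x_def x'_def Z_def)
  have "1 / C 1 = (y * Z + y') / (x * Z + x')"
    using eq nz' by (simp add: divide_simps mult.commute)
  also have "\<dots> = (x * (y * Z + y')) / (x * (x * Z + x'))"
    using nz' by simp
  also have "\<dots> = y / x + 1 / (x * (x * Z + x'))"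
    unfolding * using nz' by (simp add: add_divide_distrib)
  finally show ?thesis by (simp add: x_def x'_def y_def Z_def)
qed

text \<open>Convergence plays its part only through the recursion and the size of \<open>C\<close>:
  passing to the next error gains a factor of at least 4, so a nonzero error would make the later
  ones unbounded.\<close>

lemma hyperquadratic_relation:
  fixes \<mu> :: "nat \<Rightarrow> 'a::field"
  assumes two: "(2::'a) = 0" and t: "t \<ge> 1" and r: "r = 2 ^ t" and l: "l \<ge> 1"
    and e: "e1 \<noteq> 0" "e2 \<noteq> 0"
    and \<mu>1: "\<And>m. \<mu> (l + r * m + 1) = (e2 / e1) * e2 powi ((-1) ^ (m + 1)) * \<mu> (m + 1) ^ r"
    and \<mu>2: "\<And>m i. i \<in> {2..r} \<Longrightarrow> \<mu> (l + r * m + i) = (e1 / e2) powi ((-1) ^ i)"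
    and C: "\<And>i. i \<ge> 1 \<Longrightarrow> C i = fls_const (\<mu> i) * fls_X_inv + 1 / C (Suc i)"
    and absC: "\<And>i. i \<ge> 1 \<Longrightarrow> absF (C i) = 2"
  shows "C 1 ^ r = fls_const e1 * poly_to_F (F_poly (r - 1)) * C (l + 1) + fls_const e2 * poly_to_F (F_poly (r - 2))"
proof -
  define k :: "'a \<Rightarrow> 'a fls" where "k = fls_const"
  define T :: "'a fls" where "T = fls_X_inv"
  have two': "(2 :: 'a fls) = 0"
    using two by (metis fls_const_0 fls_const_numeral)
  have k_mult: "k (x * y) = k x * k y" for x y
    by (simp add: k_def)
  have k_power: "k (x ^ n) = k x ^ n" for x n
    by (induction n) (simp_all add: k_mult, simp add: k_def)
  have k1: "k 1 = 1" by (simp add: k_def)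
  have k_nz: "k x \<noteq> 0" if "x \<noteq> 0" for x
    using that by (simp add: k_def)
  have "even r" "r \<ge> 2"
    using t r self_le_power[of "2::nat" t] by simp_all
  \<comment> \<open>Between two terms of the first kind stand r - 1 = \<open>Suc n\<close>
    alternating ones; the parity of n decides where a factor u survives.\<close>
  then obtain n where n: "r = Suc (Suc n)" "even n"
    by (metis Suc_le_D even_Suc numeral_2_eq_2 Suc_le_mono)
  define G1 G2 where "G1 = poly_to_F (F_poly (r - 1) :: 'a poly)" and "G2 = poly_to_F (F_poly (r - 2) :: 'a poly)"
  \<comment> \<open>The place where r being a power of 2 makes F_{r-1} a monomial.\<close>
  have G1T: "G1 * T = T ^ r"
  proof -
    have "poly_to_F (monom 1 1 ^ m :: 'a poly) = T ^ m" for m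
      by (induction m) (simp_all add: T_def)
    then have "G1 = T ^ (r - 1)"
      unfolding G1_def r F_poly_pow2[OF two] by blast
    then show ?thesis by (simp add: n)
  qed
  have absG1: "absF G1 = 2 ^ Suc n" and absG2: "absF G2 = 2 ^ n"
    by (simp_all add: G1_def G2_def absF_F_poly n)
  have G1_nz: "G1 \<noteq> 0" using absG1 by auto
  define u where "u = e1 / e2"
  have u: "u \<noteq> 0" using e by (simp add: u_def)
  define d where "d m = e2 powi ((-1) ^ m)" for m :: nat
  have d: "d m \<noteq> 0" for m using e by (simp add: d_def)
  have d_Suc: "d (Suc m) = inverse (d m)" for m
    by (simp add: d_def power_int_minus)
  \<comment> \<open>\<open>B m\<close> is the value expected for \<open>C (Suc m) ^ r\<close>. Since
    \<open>d 0 = e2\<close> and \<open>u * d 0 = e1\<close>, \<open>B 0\<close> is the right-hand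
    side of the claim.\<close>
  define B where "B m = k (u * d m) * G1 * C (l + r * m + 1) + k (d m) * G2" for m
  have C_nz: "C i \<noteq> 0" if "i \<ge> 1" for i
    using absC[OF that] by auto
  have absB: "absF (B m) = 2 ^ r" for m
    unfolding B_def
    by (subst absF_add_eq) (simp_all add: absG1 absG2 absC absF_const k_def u d n)
  have B_nz: "B m \<noteq> 0" for m using absB[of m] by auto
  \<comment> \<open>The same recursion as the one for the r-th powers of \<open>C\<close>, with the
    same r-th power of a partial quotient in front.\<close>
  have B_rec: "B m = (k (\<mu> (Suc m)) * T) ^ r + 1 / B (Suc m)" for m
  proof -
    define p where "p = l + r * m + 1"
    \<comment> \<open>Shifted so that index 1 comes right after the term at p of the first kind.
      Index i here is the case \<open>i + 1\<close> of the second rule, so odd i carries u.\<close>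
    define C' a' where "C' i = C (p + i)" and "a' i = k (\<mu> (p + i)) * T" for i
    have C': "C' i = a' i + 1 / C' (Suc i)" "C' i \<noteq> 0" if "i \<ge> 1" for i
      using C[of "p + i"] C_nz[of "p + i"] that by (simp_all add: C'_def a'_def k_def T_def)
    have alt: "a' i = k (if odd i then u else inverse u) * T" if "1 \<le> i" "i \<le> Suc n" for i
      using \<mu>2[of "Suc i" m] that n
      by (simp add: a'_def p_def u_def power_int_minus)
    have x: "continuant a' (Suc n) = k u * G1"
      using continuant_alternating[of u "Suc n" a'] alt u n by (simp add: k_def T_def G1_def)
    have x': "continuant a' n = G2"
      using continuant_alternating[of u n a'] alt u n by (simp add: k_def T_def G2_def)
    \<comment> \<open>Without its first term the block starts with the inverse of u and has even
      length n, so no scalar remains.\<close>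
    have y: "tail_continuant a' (Suc n) = G2"
      using continuant_alternating[of "inverse u" n "\<lambda>i. a' (i + 1)"] alt u n by (simp add: k_def T_def G2_def)
    have C'_end: "C' (Suc (Suc n)) = C (l + r * Suc m + 1)"
      unfolding C'_def by (rule arg_cong[where f = C]) (simp add: p_def n)
    define W where "W = k u * G1 * C (l + r * Suc m + 1) + G2"
    have kd: "k (d m) * k (d (Suc m)) = 1"
      using d[of m] by (simp add: d_Suc k1 flip: k_mult)
    have W: "W = k (d m) * B (Suc m)"
      unfolding W_def B_def k_mult using kd by algebra
    have W_nz: "W \<noteq> 0" unfolding W using B_nz k_nz d by simp
    have rcp: "1 / C (p + 1) = G2 / (k u * G1) + 1 / (k u * G1 * W)"
      using reciprocal_cfrac_block[of C' a' n, OF two' C'] u k_nz[OF u] G1_nz W_nz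
      unfolding x x' y C'_end W_def[symmetric] by (simp add: C'_def)
    have Cp: "C p = k (\<mu> p) * T + 1 / C (p + 1)"
      using C[of p] by (simp add: p_def k_def T_def)
    \<comment> \<open>The first rule is shaped so that the scalars cancel and a pure r-th power
      remains.\<close>
    have \<mu>p: "u * d m * \<mu> p = \<mu> (Suc m) ^ r"
      using \<mu>1[of m] e d[of m] unfolding p_def by (simp add: u_def d_def power_int_minus field_simps)
    have "B m = k (u * d m) * G1 * (k (\<mu> p) * T + 1 / C (p + 1)) + k (d m) * G2"
      unfolding B_def p_def[symmetric] Cp[symmetric] ..
    also have "\<dots> = k (u * d m * \<mu> p) * (G1 * T) + k (d m) * (k u * G1 * (1 / C (p + 1))) + k (d m) * G2"
      by (simp add: k_mult algebra_simps)
    also have "k u * G1 * (1 / C (p + 1)) = G2 + 1 / W"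
      unfolding rcp using k_nz[OF u] G1_nz W_nz by (simp add: field_simps)
    \<comment> \<open>The convergent contributes a second copy of \<open>k (d m) * G2\<close>, and
      the two cancel in characteristic 2.\<close>
    also have "k (u * d m * \<mu> p) * (G1 * T) + k (d m) * (G2 + 1 / W) + k (d m) * G2
        = k (u * d m * \<mu> p) * (G1 * T) + k (d m) * (1 / W) + 2 * (k (d m) * G2)"
      by (simp only: ring_distribs mult_2 ac_simps)
    also have "\<dots> = (k (\<mu> (Suc m)) * T) ^ r + 1 / B (Suc m)"
      unfolding W \<mu>p G1T using B_nz k_nz d two' by (simp add: k_power power_mult_distrib)
    finally show ?thesis .
  qed
  define E where "E m = C (Suc m) ^ r - B m" for m
  have absE: "absF (E m) \<le> 2 ^ r" for m
    unfolding E_def by (rule absF_diff_le) (simp_all add: absC absB)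
  have E_step: "absF (E m) \<le> absF (E (Suc m)) / 2" for m
  proof -
    \<comment> \<open>Additivity of the r-th power carries the recursion of \<open>C\<close> over to
      its r-th powers; subtracting \<open>B_rec\<close> leaves only reciprocals.\<close>
    have "C (Suc m) ^ r = (k (\<mu> (Suc m)) * T) ^ r + 1 / C (Suc (Suc m)) ^ r"
      using C[of "Suc m"] unfolding r by (simp add: power_pow2_add[OF two'] k_def T_def power_divide)
    then have "E m = 1 / C (Suc (Suc m)) ^ r - 1 / B (Suc m)"
      unfolding E_def by (subst B_rec) simp
    moreover have "(2::real) \<le> 2 ^ r"
      using \<open>r \<ge> 2\<close> self_le_power[of "2::real" r] by simp
    then have "absF (1 / C (Suc (Suc m)) ^ r - 1 / B (Suc m)) \<le> absF (E (Suc m)) / 4"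
      unfolding E_def by (intro absF_reciprocal_diff_le) (simp_all add: absB absC)
    ultimately have "absF (E m) \<le> absF (E (Suc m)) / 4"
      by simp
    then show ?thesis
      using absF_nonneg[of "E (Suc m)"] by linarith
  qed
  have "absF (E 0) \<le> (1 / 2) ^ j * absF (E j)" for j
  proof (induction j)
    case (Suc j)
    also have "(1 / 2) ^ j * absF (E j) \<le> (1 / 2) ^ j * (absF (E (Suc j)) / 2)"
      by (intro mult_left_mono E_step) simp
    finally show ?case by simp
  qed simp
  moreover have "(1 / 2) ^ j * absF (E j) \<le> 2 ^ r * (1 / 2) ^ j" for j
    using mult_left_mono[OF absE[of j], of "(1 / 2) ^ j"] by (simp add: mult.commute)
  ultimately have "absF (E 0) \<le> 2 ^ r * (1 / 2) ^ j" for j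
    using order_trans by blast
  then have "E 0 = 0"
    by (rule absF_eq_0_of_le)
  then show ?thesis
    using e by (simp add: E_def B_def u_def d_def k_def G1_def G2_def)
qed

text \<open>Division of k = n - l - 1 by r recovers m, and the remainder is i - 1, whence the
  exponent \<open>k mod r + 1\<close>. For l = 0 the value at n = 1 would refer to itself, so this
  case is cut off.\<close>

function partial_quotient :: "nat \<Rightarrow> nat \<Rightarrow> (nat \<Rightarrow> 'a::field) \<Rightarrow> 'a \<Rightarrow> 'a \<Rightarrow> nat \<Rightarrow> 'a" where
  "partial_quotient r l lam e1 e2 n =
    (if n \<le> l \<or> l = 0 then lam n
     else let k = n - l - 1; m = k div r in
       if k mod r = 0
       then (e2 / e1) * e2 powi ((-1) ^ (m + 1)) * partial_quotient r l lam e1 e2 (m + 1) ^ r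
       else (e1 / e2) powi ((-1) ^ (k mod r + 1)))"
  by auto
termination
proof (relation "measure (\<lambda>(r, l, lam, e1, e2, n). n)")
  fix r l n k m :: nat and lam :: "nat \<Rightarrow> 'a" and e1 e2 :: 'a
  assume "\<not> (n \<le> l \<or> l = 0)" "k = n - l - 1" "m = k div r"
  then have "m + 1 < n"
    using div_le_dividend[of k r] by linarith
  then show "((r, l, lam, e1, e2, m + 1), r, l, lam, e1, e2, n) \<in> measure (\<lambda>(r, l, lam, e1, e2, n). n)"
    by simp
qed simp

declare partial_quotient.simps [simp del]

lemma partial_quotient_initial: "n \<le> l \<Longrightarrow> partial_quotient r l lam e1 e2 n = lam n"
  by (simp add: partial_quotient.simps)

lemma partial_quotient_first:
  assumes "l \<ge> 1" "r \<ge> 1"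
  shows "partial_quotient r l lam e1 e2 (l + r * m + 1)
    = (e2 / e1) * e2 powi ((-1) ^ (m + 1)) * partial_quotient r l lam e1 e2 (m + 1) ^ r"
  using assms by (subst partial_quotient.simps) (simp add: Let_def)

lemma partial_quotient_rest:
  assumes "l \<ge> 1" "i \<in> {2..r}"
  shows "partial_quotient r l lam e1 e2 (l + r * m + i) = (e1 / e2) powi ((-1) ^ i)"
proof -
  obtain j where j: "i = Suc j" "0 < j" "j < r"
    using assms by (cases i) auto
  then show ?thesis
    using assms(1) by (subst partial_quotient.simps) (simp add: Let_def)
qed

lemma partial_quotient_nonzero:
  assumes "l \<ge> 1" "r \<ge> 1" "\<forall>i\<in>{1..l}. lam i \<noteq> 0" "e1 \<noteq> 0" "e2 \<noteq> 0" "n \<ge> 1"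
  shows "partial_quotient r l lam e1 e2 n \<noteq> 0"
  using assms(6)
proof (induction n rule: less_induct)
  case (less n)
  show ?case
  proof (cases "n \<le> l")
    case True
    then show ?thesis using assms less(2) by (simp add: partial_quotient_initial)
  next
    case False
    define k where "k = n - l - 1"
    have "k div r + 1 < n"
      using False assms(1) div_le_dividend[of k r] unfolding k_def by linarith
    then have "partial_quotient r l lam e1 e2 (k div r + 1) \<noteq> 0"
      by (intro less.IH) simp_all
    then show ?thesis
      using False assms by (subst partial_quotient.simps) (simp add: Let_def k_def)
  qed
qed

text \<open>In characteristic 2, \<open>D n X / D (Suc n) X\<close> is the complete quotient of X
  after l = \<open>Suc n\<close> steps; this grouping of the equation expresses \<open>X ^ r\<close>
  through it.\<close>

lemma is_root_iff:
  fixes lam :: "nat \<Rightarrow> 'a::field"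
  defines "a \<equiv> \<lambda>i. poly_to_F (lin lam i)"
  defines "D \<equiv> \<lambda>n X. tail_continuant a n * X + continuant a n"
  shows "is_root r (Suc n) lam e1 e2 X \<longleftrightarrow>
    D (Suc n) X * (X ^ r + fls_const e2 * poly_to_F (F_poly (r - 2)))
      + fls_const e1 * poly_to_F (F_poly (r - 1)) * D n X = 0"
  unfolding is_root_def
  by (rule arg_cong[where f = "\<lambda>z. z = 0"])
    (simp add: D_def a_def poly_to_F_cont_x poly_to_F_cont_y algebra_simps del: F_poly.simps continuant.simps tail_continuant.simps)

section \<open>Uniqueness of the root\<close>

lemma is_root_unique:
  fixes lam :: "nat \<Rightarrow> 'a::field"
  assumes two: "(2::'a) = 0" and r: "r \<ge> 2" "\<And>x y :: 'a fls. (x + y) ^ r = x ^ r + y ^ r"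
    and lam: "\<And>i. 1 \<le> i \<Longrightarrow> i \<le> Suc n \<Longrightarrow> lam i \<noteq> 0"
    and e: "e1 \<noteq> 0" "e2 \<noteq> 0"
    and X: "absF X \<ge> 2" "is_root r (Suc n) lam e1 e2 X"
    and Y: "absF Y \<ge> 2" "is_root r (Suc n) lam e1 e2 Y"
  shows "X = Y"
proof -
  have two': "(2 :: 'a fls) = 0"
    using two by (metis fls_const_0 fls_const_numeral)
  define a where "a = (\<lambda>i. poly_to_F (lin lam i))"
  define x x' y y' where "x = continuant a (Suc n)" and "x' = continuant a n"
    and "y = tail_continuant a (Suc n)" and "y' = tail_continuant a n"
  define G1 G2 where "G1 = poly_to_F (F_poly (r - 1) :: 'a poly)" and "G2 = poly_to_F (F_poly (r - 2) :: 'a poly)"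
  define k1 k2 where "k1 = fls_const e1" and "k2 = fls_const e2"
  have absa: "absF (a i) = 2" if "1 \<le> i" "i \<le> Suc n" for i
    using lam[OF that] by (simp add: a_def lin_def absF_const)
  have absy: "absF y = 2 ^ n"
    unfolding y_def by (rule absF_tail_continuant) (rule absa)
  \<comment> \<open>For n = 0 the value is 0 and otherwise half the bound.\<close>
  have absy': "absF y' \<le> 2 ^ n"
  proof (cases n)
    case (Suc j)
    have "absF (tail_continuant a (Suc j)) = 2 ^ j"
      using absa Suc by (intro absF_tail_continuant) simp
    then show ?thesis using Suc by (simp add: y'_def)
  qed (simp add: y'_def)
  have det: "x * y' + x' * y = 1"
    unfolding x_def x'_def y_def y'_def using two' by (rule continuant_det)
  have k: "absF k1 = 1" "absF k2 = 1"
    using e by (simp_all add: k1_def k2_def absF_const)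
  obtain j where j: "r = Suc (Suc j)"
    using r(1) by (metis Suc_le_D numeral_2_eq_2 Suc_le_mono)
  have G: "absF G1 = 2 ^ Suc j" "absF G2 = 2 ^ j"
    by (simp_all add: G1_def G2_def absF_F_poly j)
  have key: "\<exists>b. b * (y * Z + x) = y' * Z + x' \<and> Z ^ r = k1 * G1 * b + k2 * G2
      \<and> y * Z + x \<noteq> 0 \<and> absF (y * Z + x) \<le> 1 / 2"
    if Z: "absF Z \<ge> 2" "is_root r (Suc n) lam e1 e2 Z" for Z
  proof -
    have eq: "(y * Z + x) * (Z ^ r + k2 * G2) + k1 * G1 * (y' * Z + x') = 0"
      using Z(2) unfolding is_root_iff x_def x'_def y_def y'_def k1_def k2_def G1_def G2_def a_def
      by simp
    have nz: "k1 * G1 \<noteq> 0" using k G by auto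
    \<comment> \<open>The candidate complete quotient, read off from the r-th power; the equation
      then makes it the Moebius preimage of Z.\<close>
    define b where "b = (Z ^ r + k2 * G2) / (k1 * G1)"
    have b: "Z ^ r + k2 * G2 = k1 * G1 * b"
      using nz by (simp add: b_def)
    have "k1 * G1 * (b * (y * Z + x) - (y' * Z + x'))
        = ((y * Z + x) * (k1 * G1 * b) + k1 * G1 * (y' * Z + x')) - 2 * (k1 * G1 * (y' * Z + x'))"
      by algebra
    then have "k1 * G1 * (b * (y * Z + x) - (y' * Z + x')) = 0"
      using eq two' unfolding b by simp
    then have 1: "b * (y * Z + x) = y' * Z + x'"
      using nz by simp
    have 2: "Z ^ r = k1 * G1 * b + k2 * G2"
    proof -
      have "Z ^ r = Z ^ r + k2 * G2 + k2 * G2"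
        using two' mult_2[of "k2 * G2"] by simp
      then show ?thesis unfolding b .
    qed
    \<comment> \<open>By the determinant, \<open>y * b + y'\<close> is the inverse of
      \<open>y * Z + x\<close>; as b has size at least 2, the former is large and the latter
      small.\<close>
    have 3: "(y * Z + x) * (y * b + y') = 1"
    proof -
      have "(y * Z + x) * (y * b + y') = y * (b * (y * Z + x)) + y' * (y * Z + x)"
        by algebra
      also have "\<dots> = 2 * (y * y' * Z) + (x * y' + x' * y)"
        unfolding 1 by algebra
      finally show ?thesis using det two' by simp
    qed
    have Zr: "absF (Z ^ r) \<ge> 2 ^ r"
      using Z by (simp add: power_mono)
    moreover have "absF (k2 * G2) < 2 ^ r"
      by (simp add: k G j)
    ultimately have "absF (Z ^ r + k2 * G2) \<ge> 2 ^ r"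
      by (subst absF_add_eq) linarith+
    then have "2 ^ Suc j * absF b \<ge> 2 ^ Suc j * 2"
      unfolding b by (simp add: k G j)
    then have absb: "absF b \<ge> 2" by simp
    have "2 ^ n * 2 \<le> absF (y * b)"
      using absb absy by simp
    moreover have "absF y' < 2 ^ n * 2"
      using absy' by (rule le_less_trans) simp
    ultimately have "absF (y * b + y') = absF (y * b)"
      by (intro absF_add_eq) linarith
    then have "absF (y * b + y') \<ge> 2"
      using \<open>2 ^ n * 2 \<le> absF (y * b)\<close> one_le_power[of "2::real" n] by linarith
    moreover have "absF (y * Z + x) * absF (y * b + y') = 1"
      using 3 by (simp flip: absF_mult)
    ultimately have "absF (y * Z + x) \<le> 1 / 2"
      by (metis absF_nonneg mult_left_mono mult.commute pos_le_divide_eq zero_less_numeral)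
    then show ?thesis using 1 2 3 by force
  qed
  obtain b where b: "b * (y * X + x) = y' * X + x'" "X ^ r = k1 * G1 * b + k2 * G2"
    "y * X + x \<noteq> 0" "absF (y * X + x) \<le> 1 / 2" using key[OF X] by blast
  obtain c where c: "c * (y * Y + x) = y' * Y + x'" "Y ^ r = k1 * G1 * c + k2 * G2"
    "y * Y + x \<noteq> 0" "absF (y * Y + x) \<le> 1 / 2" using key[OF Y] by blast
  \<comment> \<open>In characteristic 2 this is the difference of the two roots.\<close>
  define \<delta> where "\<delta> = X + Y"
  have "absF (y * \<delta>) \<le> 1 / 2"
  proof -
    have "y * \<delta> = (y * X + x) + (y * Y + x) - 2 * x"
      unfolding \<delta>_def by algebra
    then have "y * \<delta> = (y * X + x) + (y * Y + x)"
      using two' by simp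
    then show ?thesis using b c by (simp only: absF_add_le)
  qed
  then have \<delta>: "absF \<delta> \<le> 1 / 2"
    using absy one_le_power[of "2::real" n] mult_right_mono[of 1 "2 ^ n" "absF \<delta>"] by simp
  \<comment> \<open>A Moebius map of determinant 1 changes a difference by the product of the two
    denominators.\<close>
  have 1: "(b + c) * ((y * X + x) * (y * Y + x)) = \<delta>"
  proof -
    have "(b + c) * ((y * X + x) * (y * Y + x)) = (b * (y * X + x)) * (y * Y + x) + (c * (y * Y + x)) * (y * X + x)"
      by algebra
    also have "\<dots> = (y' * X + x') * (y * Y + x) + (y' * Y + x') * (y * X + x)"
      unfolding b(1) c(1) ..
    also have "\<dots> = (x * y' + x' * y) * \<delta> + 2 * (y * y' * X * Y + x * x')"
      unfolding \<delta>_def by algebra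
    finally show ?thesis using det two' by simp
  qed
  have 2: "\<delta> ^ r = k1 * G1 * (b + c)"
  proof -
    have "\<delta> ^ r = k1 * G1 * (b + c) + 2 * (k2 * G2)"
      unfolding \<delta>_def r(2) b(2) c(2) by algebra
    then show ?thesis using two' by simp
  qed
  have "\<delta> = 0"
  proof (rule ccontr)
    assume nz: "\<delta> \<noteq> 0"
    \<comment> \<open>Eliminating b + c and dividing by \<delta> leaves a product of factors of size
      at most 1 equal to something of size 2^(r-1).\<close>
    have "\<delta> ^ r * ((y * X + x) * (y * Y + x)) = k1 * G1 * \<delta>"
      unfolding 2 by (simp only: mult.assoc 1)
    then have "\<delta> ^ Suc j * ((y * X + x) * (y * Y + x)) = k1 * G1"
      using nz by (simp add: j mult.assoc)
    then have "absF \<delta> ^ Suc j * (absF (y * X + x) * absF (y * Y + x)) = 2 ^ Suc j"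
      using k G by (metis absF_mult absF_power mult_1_left)
    moreover have "absF \<delta> ^ Suc j * (absF (y * X + x) * absF (y * Y + x)) \<le> 1 * (1 * 1)"
      using b c \<delta> by (intro mult_mono power_le_one) auto
    moreover have "(2::real) ^ Suc j > 1"
      by (rule one_less_power) simp_all
    ultimately show False by linarith
  qed
  then show ?thesis
    unfolding \<delta>_def using two' mult_2[of Y] by (metis add_right_imp_eq mult_zero_left)
qed

section \<open>Existence of the root and its expansion\<close>

theorem mainTheorem1:
  fixes s t q r l :: nat
    and lam :: "nat \<Rightarrow> 'a::{field,finite}"
    and \<epsilon>1 \<epsilon>2 :: 'a
  assumes "s \<ge> 1" and "t \<ge> 1" and "q = 2 ^ s" and "r = 2 ^ t"
    and "CARD('a) = q"
    and "l \<ge> 1"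
    and "\<forall>i\<in>{1..l}. lam i \<noteq> 0" and "\<epsilon>1 \<noteq> 0" and "\<epsilon>2 \<noteq> 0"
  shows "(\<exists>!\<alpha>. \<alpha> \<in> F_plus \<and> is_root r l lam \<epsilon>1 \<epsilon>2 \<alpha>) \<and>
    (\<exists>\<mu> :: nat \<Rightarrow> 'a.
      (\<forall>i\<in>{1..l}. \<mu> i = lam i) \<and>
      (\<forall>n\<ge>1. \<mu> n \<noteq> 0) \<and>
      (\<forall>m. \<mu> (l + r * m + 1) = (\<epsilon>2 / \<epsilon>1) * \<epsilon>2 powi ((-1) ^ (m + 1)) * \<mu> (m + 1) ^ r) \<and>
      (\<forall>m. \<forall>i\<in>{2..r}. \<mu> (l + r * m + i) = (\<epsilon>1 / \<epsilon>2) powi ((-1) ^ i)) \<and>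
      (\<forall>\<alpha>. \<alpha> \<in> F_plus \<and> is_root r l lam \<epsilon>1 \<epsilon>2 \<alpha> \<longrightarrow> has_cfrac_expansion \<alpha> (lin \<mu>)))"
proof -
  have two: "(2::'a) = 0"
    using assms(3,5) by (intro two_eq_0_of_CARD) simp
  have two': "(2 :: 'a fls) = 0"
    using two by (metis fls_const_0 fls_const_numeral)
  have r2: "r \<ge> 2"
    using assms(2,4) self_le_power[of "2::nat" t] by simp
  obtain n where n: "l = Suc n"
    using assms(6) by (cases l) auto
  define \<mu> where "\<mu> = partial_quotient r l lam \<epsilon>1 \<epsilon>2"
  define a where "a = (\<lambda>i. poly_to_F (lin \<mu> i))"
  have a: "a i = fls_const (\<mu> i) * fls_X_inv" for i
    by (simp add: a_def lin_def)
  have \<mu>_init: "\<mu> i = lam i" if "i \<le> l" for i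
    using that by (simp add: \<mu>_def partial_quotient_initial)
  have \<mu>_nz: "\<mu> i \<noteq> 0" if "i \<ge> 1" for i
    unfolding \<mu>_def using assms r2 that by (intro partial_quotient_nonzero) auto
  have \<mu>_first: "\<mu> (l + r * m + 1) = (\<epsilon>2 / \<epsilon>1) * \<epsilon>2 powi ((-1) ^ (m + 1)) * \<mu> (m + 1) ^ r" for m
    unfolding \<mu>_def using assms r2 by (intro partial_quotient_first) auto
  have \<mu>_rest: "\<mu> (l + r * m + i) = (\<epsilon>1 / \<epsilon>2) powi ((-1) ^ i)" if "i \<in> {2..r}" for m i
    unfolding \<mu>_def using assms that by (intro partial_quotient_rest) auto
  have absa: "absF (a i) = 2" if "i \<ge> 1" for i
    using \<mu>_nz[OF that] by (simp add: a absF_const)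
  then have "absF (a i) \<ge> 2" if "i \<ge> 1" for i
    using that by simp
  then obtain C where C': "\<forall>i\<ge>1. C i = a i + 1 / C (Suc i)"
    and absC': "\<forall>i\<ge>1. absF (C i) = absF (a i)"
    and lim: "(\<lambda>n. finite_cfrac (map a [1..<Suc n])) \<longlonglongrightarrow> C 1"
    by (rule cfrac_complete_quotients)
  have C: "C i = a i + 1 / C (Suc i)" if "i \<ge> 1" for i
    by (rule C'[rule_format, OF that])
  have absC: "absF (C i) = 2" if "i \<ge> 1" for i
    using absC' absa that by simp
  then have C_nz: "C i \<noteq> 0" if "i \<ge> 1" for i
    using that by fastforce
  have expansion: "has_cfrac_expansion (C 1) (lin \<mu>)"
    using lim \<mu>_nz by (simp add: has_cfrac_expansion_def a_def lin_def degree_monom_eq del: upt_Suc)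
  have rel: "C 1 ^ r = fls_const \<epsilon>1 * poly_to_F (F_poly (r - 1)) * C (l + 1) + fls_const \<epsilon>2 * poly_to_F (F_poly (r - 2))"
    using two assms(2,4,6,8,9) \<mu>_first \<mu>_rest C[unfolded a] absC by (rule hyperquadratic_relation)
  \<comment> \<open>The equation is built from \<open>lam\<close> and the expansion from \<mu>; they
    agree up to index l, which is all these continuants see.\<close>
  have cont: "continuant (\<lambda>i. poly_to_F (lin lam i)) k = continuant a k"
    "tail_continuant (\<lambda>i. poly_to_F (lin lam i)) k = tail_continuant a k" if "k \<le> l" for k
    using that \<mu>_init by (auto simp: a_def lin_def intro!: continuant_cong tail_continuant_cong)
  have root: "is_root r l lam \<epsilon>1 \<epsilon>2 (C 1)"
  proof -
    define x x' y y' where "x = continuant a (Suc n)" and "x' = continuant a n"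
      and "y = tail_continuant a (Suc n)" and "y' = tail_continuant a n"
    define Z K1 K2 where "Z = C (l + 1)" and "K1 = fls_const \<epsilon>1 * poly_to_F (F_poly (r - 1))"
      and "K2 = fls_const \<epsilon>2 * poly_to_F (F_poly (r - 2))"
    have 1: "C 1 * (y * Z + y') = x * Z + x'"
      using cfrac_tail[where C = C and a = a and n = n, OF C C_nz] by (simp add: x_def x'_def y_def y'_def Z_def n del: continuant.simps tail_continuant.simps)
    have 2: "C 1 ^ r = K1 * Z + K2"
      using rel by (simp add: Z_def K1_def K2_def)
    \<comment> \<open>After substituting the relation for the r-th power, the left side is the
      Moebius relation times \<open>K1\<close> plus terms that occur twice.\<close>
    have "(y * C 1 + x) * (C 1 ^ r + K2) + K1 * (y' * C 1 + x')
        = K1 * (C 1 * (y * Z + y') - (x * Z + x')) + 2 * ((y * C 1 + x) * K2 + K1 * (x * Z + x'))"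
      unfolding 2 by algebra
    then have "(y * C 1 + x) * (C 1 ^ r + K2) + K1 * (y' * C 1 + x') = 0"
      using 1 two' by simp
    then show ?thesis
      unfolding n is_root_iff using cont[of n] cont[of "Suc n"]
      by (simp add: n x_def x'_def y_def y'_def K1_def K2_def del: continuant.simps tail_continuant.simps F_poly.simps)
  qed
  have F: "C 1 \<in> F_plus"
    using absC[of 1] by (simp add: F_plus_iff_absF)
  have unique: "\<alpha> = C 1" if \<alpha>: "\<alpha> \<in> F_plus" "is_root r l lam \<epsilon>1 \<epsilon>2 \<alpha>" for \<alpha>
  proof (rule is_root_unique[OF two r2])
    show "(x + y) ^ r = x ^ r + y ^ r" for x y :: "'a fls"
      unfolding assms(4) by (rule power_pow2_add[OF two'])
    show "lam i \<noteq> 0" if "1 \<le> i" "i \<le> Suc n" for i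
      using that assms(7) n by simp
    show "is_root r (Suc n) lam \<epsilon>1 \<epsilon>2 \<alpha>" "is_root r (Suc n) lam \<epsilon>1 \<epsilon>2 (C 1)"
      using \<alpha>(2) root unfolding n .
    show "2 \<le> absF \<alpha>" "2 \<le> absF (C 1)"
      using \<alpha>(1) F unfolding F_plus_iff_absF .
  qed (fact assms)+
  have "\<exists>!\<alpha>. \<alpha> \<in> F_plus \<and> is_root r l lam \<epsilon>1 \<epsilon>2 \<alpha>"
    using F root unique by blast
  moreover have "has_cfrac_expansion \<alpha> (lin \<mu>)" if "\<alpha> \<in> F_plus \<and> is_root r l lam \<epsilon>1 \<epsilon>2 \<alpha>" for \<alpha>
    using unique[of \<alpha>] that expansion by blast
  moreover have "\<forall>i\<in>{1..l}. \<mu> i = lam i"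
    by (simp add: \<mu>_init)
  ultimately show ?thesis
    by (intro conjI exI[of _ \<mu>] allI ballI impI \<mu>_nz \<mu>_first \<mu>_rest) blast+
qed

end
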